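(* Let $a\in\mathbb{Z}_{\geq -1}$, let $\rho$ be the largest root of $x^3-ax^2-(a+3)x-1$, let $K=\mathbb{Q}(\rho)$, and assume that $\mathcal{O}_K=\mathbb{Z}[\rho]$. Then the element $1+\rho+\rho^2$ is indecomposable in $\mathcal{O}_K$. Moreover, $$\min_{\delta\in\mathcal{O}_K^{\vee,+}}\mathrm{Tr}\big((1+\rho+\rho^2)\delta\big)=2.$$
   Context: The field $K$ is totally real. An element of $K$ is totally positive if all its images under embeddings $K\hookrightarrow\mathbb{R}$ are positive; $\mathcal{O}_K^+$ is the set of totally positive elements of $\mathcal{O}_K$. An element $\alpha\in\mathcal{O}_K^+$ is indecomposable if it cannot be written as $\alpha=\beta+\gamma$ with $\beta,\gamma\in\mathcal{O}_K^+$. $\mathrm{Tr}$ is the trace from $K$ to $\mathbb{Q}$. The codifferent is $\mathcal{O}_K^{\vee}=\{\delta\in K\mid \mathrm{Tr}(\alpha\delta)\in\mathbb{Z}\text{ for all }\alpha\in\mathcal{O}_K\}$, and $\mathcal{O}_K^{\vee,+}$ is the set of its totally positive elements. *)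

theory Defs
  imports Complex_Main "HOL-Computational_Algebra.Polynomial"
begin

(* Number fields are represented as subsets of the ambient field of real numbers. *)

definition is_subring :: "real set \<Rightarrow> bool" where
  "is_subring R \<longleftrightarrow> 0 \<in> R \<and> 1 \<in> R \<and>
     (\<forall>x\<in>R. \<forall>y\<in>R. x + y \<in> R \<and> x * y \<in> R) \<and> (\<forall>x\<in>R. - x \<in> R)"

definition is_subfield :: "real set \<Rightarrow> bool" where
  "is_subfield F \<longleftrightarrow> is_subring F \<and> (\<forall>x\<in>F. x \<noteq> 0 \<longrightarrow> inverse x \<in> F)"

(* A subfield of the reals automatically contains the rationals, and a subring the integers. *)

definition rat_adjoin :: "real \<Rightarrow> real set" where
  "rat_adjoin x = is_subfield hull {x}"

definition int_adjoin :: "real \<Rightarrow> real set" where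
  "int_adjoin x = is_subring hull {x}"

definition ring_of_integers :: "real set \<Rightarrow> real set" where
  "ring_of_integers K = {x \<in> K. algebraic_int x}"

(* Only the values of the function on K matter. *)
definition real_embedding :: "real set \<Rightarrow> (real \<Rightarrow> real) \<Rightarrow> bool" where
  "real_embedding K \<sigma> \<longleftrightarrow> \<sigma> 1 = 1 \<and>
     (\<forall>x\<in>K. \<forall>y\<in>K. \<sigma> (x + y) = \<sigma> x + \<sigma> y \<and> \<sigma> (x * y) = \<sigma> x * \<sigma> y)"

definition totally_positive :: "real set \<Rightarrow> real \<Rightarrow> bool" where
  "totally_positive K x \<longleftrightarrow> (\<forall>\<sigma>. real_embedding K \<sigma> \<longrightarrow> \<sigma> x > 0)"

definition positive_integers :: "real set \<Rightarrow> real set" where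
  "positive_integers K = {x \<in> ring_of_integers K. totally_positive K x}"

definition indecomposable :: "real set \<Rightarrow> real \<Rightarrow> bool" where
  "indecomposable K x \<longleftrightarrow> x \<in> positive_integers K \<and>
     \<not> (\<exists>y\<in>positive_integers K. \<exists>z\<in>positive_integers K. x = y + z)"

interpretation rat_vs: vector_space "\<lambda>(q::rat) (x::real). of_rat q * x"
  by unfold_locales (simp_all add: algebra_simps of_rat_add of_rat_mult)

(* The trace of the rational-linear map given by multiplication by x on K, as the sum of the
   diagonal entries of its matrix; the result does not depend on the chosen basis. It is meaningful
   only when K has finite degree. *)
definition field_trace :: "real set \<Rightarrow> real \<Rightarrow> rat" where
  "field_trace K x =
     (let B = (SOME B. rat_vs.independent B \<and> rat_vs.span B = K)
      in \<Sum>b\<in>B. rat_vs.representation B (x * b) b)"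

definition codifferent :: "real set \<Rightarrow> real set" where
  "codifferent K = {\<delta> \<in> K. \<forall>\<alpha>\<in>ring_of_integers K. field_trace K (\<alpha> * \<delta>) \<in> \<int>}"

definition positive_codifferent :: "real set \<Rightarrow> real set" where
  "positive_codifferent K = {\<delta> \<in> codifferent K. totally_positive K \<delta>}"

definition is_minimum :: "'a::linorder \<Rightarrow> 'a set \<Rightarrow> bool" where
  "is_minimum m A \<longleftrightarrow> m \<in> A \<and> (\<forall>x\<in>A. m \<le> x)"

end

theory Submission
  imports Defs
begin

text \<open>Put \<open>N = 1 + \<rho> + \<rho>\<^sup>2\<close>. Since \<open>2 N = 1 + \<rho>\<^sup>2 + (1 + \<rho>)\<^sup>2\<close> is a sum of three totally positive
  integers, \<open>Tr (N \<delta>) \<ge> 3/2\<close>, hence \<open>Tr (N \<delta>) \<ge> 2\<close>, for every totally positive \<open>\<delta>\<close> in the codifferent.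
  Equality holds for the squares of \<open>(1 + \<rho>) / N\<close>, \<open>\<rho> / N\<close> and \<open>1 / N\<close>, whose traces against
  \<open>u + v \<rho> + w \<rho>\<^sup>2\<close> are \<open>u + w\<close>, \<open>u - v + 2 w\<close> and \<open>2 u - v + w\<close>. A totally positive integral summand
  of \<open>N\<close> would have trace 1 against all three, which forces \<open>u = w\<close> and \<open>u + w = 1\<close>.

  The conjugates of \<open>\<rho>\<close> are \<open>- (1 + \<rho>) / \<rho>\<close> and \<open>- 1 / (1 + \<rho>)\<close>, so the trace is an explicit
  rational function of \<open>\<rho>\<close>.\<close>

section \<open>Subrings and subfields of the reals\<close>

lemma is_subfield_rat_adjoin: "is_subfield (rat_adjoin x)"
  unfolding rat_adjoin_def
  by (rule hull_in) (auto simp: is_subfield_def is_subring_def)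

lemma is_subring_int_adjoin: "is_subring (int_adjoin x)"
  unfolding int_adjoin_def
  by (rule hull_in) (auto simp: is_subring_def)

lemma is_subring_of_nat: "is_subring R \<Longrightarrow> of_nat n \<in> R"
  by (induction n) (auto simp: is_subring_def)

lemma is_subring_of_int:
  assumes "is_subring R"
  shows "of_int n \<in> R"
  using is_subring_of_nat[OF assms] assms by (cases n rule: int_cases2) (auto simp: is_subring_def)

lemma is_subring_power: "is_subring R \<Longrightarrow> x \<in> R \<Longrightarrow> x ^ n \<in> R"
  by (induction n) (auto simp: is_subring_def)

lemma is_subfield_of_rat:
  assumes "is_subfield F"
  shows "of_rat q \<in> F"
proof (cases q)
  case (Fract m n)
  then have "(of_rat q :: real) = of_int m * inverse (of_int n)"
    by (simp add: of_rat_rat divide_inverse)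
  then show ?thesis
    using assms is_subring_of_int[of F] Fract(2) by (simp add: is_subfield_def is_subring_def)
qed

section \<open>Real embeddings of a subfield\<close>

context
  fixes K :: "real set" and \<sigma> :: "real \<Rightarrow> real"
  assumes K: "is_subfield K" and \<sigma>: "real_embedding K \<sigma>"
begin

lemma embedding_add: "x \<in> K \<Longrightarrow> y \<in> K \<Longrightarrow> \<sigma> (x + y) = \<sigma> x + \<sigma> y"
  and embedding_mult: "x \<in> K \<Longrightarrow> y \<in> K \<Longrightarrow> \<sigma> (x * y) = \<sigma> x * \<sigma> y"
  and embedding_one: "\<sigma> 1 = 1"
  using \<sigma> by (auto simp: real_embedding_def)

lemma embedding_zero: "\<sigma> 0 = 0"
  using embedding_add[of 0 0] K by (auto simp: is_subfield_def is_subring_def)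

lemma embedding_minus: "x \<in> K \<Longrightarrow> \<sigma> (- x) = - \<sigma> x"
  using embedding_add[of x "- x"] embedding_zero K by (auto simp: is_subfield_def is_subring_def)

lemma embedding_inverse:
  assumes "x \<in> K"
  shows "\<sigma> (inverse x) = inverse (\<sigma> x)"
proof (cases "x = 0")
  case False
  then have "\<sigma> x * \<sigma> (inverse x) = 1"
    using embedding_mult[of x "inverse x"] embedding_one assms K by (auto simp: is_subfield_def)
  then show ?thesis by (metis inverse_unique)
qed (simp add: embedding_zero)

lemma embedding_nonzero: "x \<in> K \<Longrightarrow> x \<noteq> 0 \<Longrightarrow> \<sigma> x \<noteq> 0"
  using embedding_mult[of x "inverse x"] embedding_one K by (auto simp: is_subfield_def)

lemma embedding_power: "x \<in> K \<Longrightarrow> \<sigma> (x ^ n) = \<sigma> x ^ n"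
  using K by (induction n)
    (auto simp: is_subfield_def embedding_one embedding_mult is_subring_power)

lemma embedding_of_nat: "\<sigma> (of_nat n) = of_nat n"
proof (induction n)
  case (Suc n)
  then show ?case
    using embedding_add[of 1 "of_nat n"] is_subring_of_nat[of K n] K
    by (auto simp: is_subfield_def is_subring_def embedding_one)
qed (simp add: embedding_zero)

lemma embedding_of_int: "\<sigma> (of_int n) = of_int n"
  using K is_subring_of_nat[of K]
  by (cases n rule: int_cases2) (auto simp: embedding_of_nat embedding_minus is_subfield_def)

lemma embedding_of_rat: "\<sigma> (of_rat q) = of_rat q"
proof (cases q)
  case (Fract m n)
  then have "(of_rat q :: real) = of_int m * inverse (of_int n)"
    by (simp add: of_rat_rat divide_inverse)
  then show ?thesis
    using K Fract(2) is_subring_of_int[of K]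
    by (simp add: is_subfield_def embedding_mult embedding_inverse embedding_of_int)
qed

end

text \<open>An embedding of a field is injective, so a nonzero element goes to a nonzero real, whose
  square is positive.\<close>

lemma totally_positive_power2:
  assumes "is_subfield K" "x \<in> K" "x \<noteq> 0"
  shows "totally_positive K (x\<^sup>2)"
  unfolding totally_positive_def
  using assms by (auto simp: embedding_power embedding_nonzero)

section \<open>Linear algebra over the rationals: traces and inverses\<close>

text \<open>Expanding along one basis and then along the other turns the diagonal sum over the first
  into the diagonal sum over the second, as in \<open>tr (P Q) = tr (Q P)\<close>.\<close>

lemma diagonal_sum_basis_change:
  assumes B: "rat_vs.independent B" "finite B" and C: "rat_vs.independent C" "finite C"
    and span: "rat_vs.span B = rat_vs.span C"
    and closed: "\<And>y. y \<in> rat_vs.span C \<Longrightarrow> x * y \<in> rat_vs.span C"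
  shows "(\<Sum>b\<in>B. rat_vs.representation B (x * b) b) = (\<Sum>c\<in>C. rat_vs.representation C (x * c) c)"
proof -
  let ?R = rat_vs.representation
  have "?R B (x * b) b = (\<Sum>c\<in>C. ?R C (x * b) c * ?R B c b)" if "b \<in> B" for b
  proof -
    have b: "x * b \<in> rat_vs.span C"
      using closed span rat_vs.span_base that by metis
    have "x * b = (\<Sum>c\<in>C. of_rat (?R C (x * b) c) * c)"
      using rat_vs.sum_representation_eq[OF C(1) b C(2) order_refl] by simp
    then have "?R B (x * b) b = ?R B (\<Sum>c\<in>C. of_rat (?R C (x * b) c) * c) b"
      by simp
    also have "\<dots> = (\<Sum>c\<in>C. ?R B (of_rat (?R C (x * b) c) * c) b)"
      using B span by (subst rat_vs.representation_sum) (auto intro: rat_vs.span_scale rat_vs.span_base)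
    also have "\<dots> = (\<Sum>c\<in>C. ?R C (x * b) c * ?R B c b)"
      using B span by (intro sum.cong refl)
        (subst rat_vs.representation_scale, auto intro: rat_vs.span_base)
    finally show ?thesis .
  qed
  then have "(\<Sum>b\<in>B. ?R B (x * b) b) = (\<Sum>b\<in>B. \<Sum>c\<in>C. ?R C (x * b) c * ?R B c b)"
    by (intro sum.cong refl)
  also have "\<dots> = (\<Sum>c\<in>C. \<Sum>b\<in>B. ?R B c b * ?R C (x * b) c)"
    by (subst sum.swap) (simp add: mult.commute)
  also have "\<dots> = (\<Sum>c\<in>C. ?R C (x * c) c)"
  proof (intro sum.cong refl)
    fix c assume "c \<in> C"
    then have c: "c \<in> rat_vs.span B"
      using span rat_vs.span_base by metis
    have "c = (\<Sum>b\<in>B. of_rat (?R B c b) * b)"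
      using rat_vs.sum_representation_eq[OF B(1) c B(2) order_refl] by simp
    then have "?R C (x * c) c = ?R C (x * (\<Sum>b\<in>B. of_rat (?R B c b) * b)) c"
      by simp
    also have "x * (\<Sum>b\<in>B. of_rat (?R B c b) * b) = (\<Sum>b\<in>B. of_rat (?R B c b) * (x * b))"
      by (simp add: sum_distrib_left algebra_simps)
    also have "?R C \<dots> c = (\<Sum>b\<in>B. ?R C (of_rat (?R B c b) * (x * b)) c)"
      using C span closed
      by (subst rat_vs.representation_sum)
        (auto intro!: rat_vs.span_scale closed intro: rat_vs.span_base)
    also have "\<dots> = (\<Sum>b\<in>B. ?R B c b * ?R C (x * b) c)"
      using C span closed by (intro sum.cong refl)
        (subst rat_vs.representation_scale, auto intro!: closed intro: rat_vs.span_base)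
    finally show "(\<Sum>b\<in>B. ?R B c b * ?R C (x * b) c) = ?R C (x * c) c" ..
  qed
  finally show ?thesis .
qed

text \<open>This replaces the basis picked by \<open>SOME\<close> with any convenient finite one.
  The finite spanning set \<open>C\<close> bounds the size of every independent set in its span, so
  the picked basis is finite too and the change of basis applies.\<close>

lemma field_trace_eq_diagonal_sum:
  assumes C: "rat_vs.independent C" "finite C" "rat_vs.span C = K"
    and closed: "\<And>y. y \<in> K \<Longrightarrow> x * y \<in> K"
  shows "field_trace K x = (\<Sum>c\<in>C. rat_vs.representation C (x * c) c)"
proof -
  define B where "B = (SOME B. rat_vs.independent B \<and> rat_vs.span B = K)"
  have B: "rat_vs.independent B \<and> rat_vs.span B = K"
    unfolding B_def by (rule someI[of _ C]) (use C in auto)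
  have "B \<subseteq> rat_vs.span C"
    using B C(3) rat_vs.span_superset by blast
  then have "finite B"
    using rat_vs.independent_span_bound[OF C(2)] B by blast
  then show ?thesis
    unfolding field_trace_def B_def[symmetric] Let_def
    using B C closed by (intro diagonal_sum_basis_change) auto
qed

text \<open>Multiplication by \<open>x\<close> is injective on a finite-dimensional space, hence surjective.\<close>

lemma inverse_in_finite_span:
  assumes B: "rat_vs.independent B" "finite B" and "x \<noteq> 0" "1 \<in> rat_vs.span B"
    and closed: "\<And>y. y \<in> rat_vs.span B \<Longrightarrow> x * y \<in> rat_vs.span B"
  shows "inverse x \<in> rat_vs.span B"
proof -
  interpret lin: Vector_Spaces.linear "\<lambda>(q::rat) (x::real). of_rat q * x"
      "\<lambda>(q::rat) (x::real). of_rat q * x" "\<lambda>y. x * y"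
    by unfold_locales (auto simp: algebra_simps)
  let ?C = "(\<lambda>y. x * y) ` B"
  have inj: "inj_on (\<lambda>y. x * y) S" for S
    using \<open>x \<noteq> 0\<close> by (auto simp: inj_on_def)
  have C: "rat_vs.independent ?C"
    using lin.independent_injective_image[OF B(1) inj] .
  have "1 \<in> rat_vs.span ?C"
  \<comment> \<open>Otherwise adding 1 to the image of \<open>B\<close> would give
    \<open>card B + 1\<close> independent vectors inside the span of \<open>B\<close>.\<close>
  proof (rule ccontr)
    assume 1: "1 \<notin> rat_vs.span ?C"
    then have "1 \<notin> ?C"
      using rat_vs.span_base by blast
    moreover have "rat_vs.independent (insert 1 ?C)"
      using C 1 by (simp add: rat_vs.independent_insert)
    moreover have "insert 1 ?C \<subseteq> rat_vs.span B"
      using assms rat_vs.span_base by auto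
    ultimately have "card (insert 1 ?C) \<le> card B"
      using rat_vs.independent_span_bound[OF B(2)] by blast
    then show False
      using \<open>1 \<notin> ?C\<close> B(2) card_image[OF inj] by simp
  qed
  then obtain y where "y \<in> rat_vs.span B" "1 = x * y"
    using lin.span_image[of B] by auto
  then show ?thesis
    using inverse_unique by metis
qed

section \<open>The cubic: irreducibility and conjugate roots\<close>

text \<open>The cubic is monic and integral, so a rational root is an integer, and it divides the
  constant term -1.\<close>

lemma rational_not_root:
  fixes a :: int and q :: real
  assumes "q \<in> \<rat>"
  shows "q ^ 3 - of_int a * q\<^sup>2 - (of_int a + 3) * q - 1 \<noteq> 0"
proof
  assume *: "q ^ 3 - of_int a * q\<^sup>2 - (of_int a + 3) * q - 1 = 0"
  have "algebraic_int q"
  proof (rule algebraic_int.intros)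
    let ?p = "[: - 1, - (of_int a + 3), - of_int a, 1 :] :: real poly"
    show "lead_coeff ?p = 1" by simp
    show "\<forall>i. coeff ?p i \<in> \<int>"
      by (simp add: coeff_pCons split: nat.splits)
    show "poly ?p q = 0"
      using * by (simp add: power2_eq_square power3_eq_cube algebra_simps)
  qed
  then obtain n where n: "q = of_int n"
    using assms rational_algebraic_int_is_int Ints_cases by metis
  have "of_int (n ^ 3 - a * n\<^sup>2 - (a + 3) * n - 1) = (0 :: real)"
    using * unfolding n by simp
  then have eq: "n ^ 3 - a * n\<^sup>2 - (a + 3) * n - 1 = 0"
    by linarith
  then have "n * (n\<^sup>2 - a * n - (a + 3)) = 1"
    by (simp add: power2_eq_square power3_eq_cube algebra_simps)
  then have "n = 1 \<or> n = -1"
    by (auto simp: zmult_eq_1_iff)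
  then show False
    \<comment> \<open>The cubic takes the value \<open>- 2 * a - 3\<close> at 1, which is odd, and
      the value 1 at -1.\<close>
    using eq by auto presburger
qed

text \<open>The root is a parameter so that everything proved for \<open>r\<close> can be
  instantiated at its conjugates as well.\<close>

locale simplest_cubic_root =
  fixes a :: int and r :: real
  assumes root: "r ^ 3 = of_int a * r\<^sup>2 + (of_int a + 3) * r + 1"
begin

lemma irrational: "r \<notin> \<rat>"
  using rational_not_root[of r a] root by auto

text \<open>A quadratic relation for \<open>r\<close> would split the cubic into a rational
  quadratic and a rational linear factor, and the latter would have a rational root.\<close>

lemma rational_coefficients_zero:
  assumes "of_rat p + of_rat q * r + of_rat s * r\<^sup>2 = 0"
  shows "p = 0 \<and> q = 0 \<and> s = 0"
proof -
  have linear: "A = 0 \<and> B = 0" if "of_rat A + of_rat B * r = 0" for A B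
  proof -
    have "B = 0"
    proof (rule ccontr)
      assume "B \<noteq> 0"
      then have "r = of_rat (- A / B)"
        using that by (simp add: of_rat_divide of_rat_minus field_simps)
      then show False
        using irrational by simp
    qed
    then show ?thesis using that by simp
  qed
  have "s = 0"
  proof (rule ccontr)
    assume "s \<noteq> 0"
    \<comment> \<open>The roots of \<open>x^2 - A x - B\<close> have sum \<open>A\<close> and those
      of the cubic have sum \<open>a\<close>, so \<open>c\<close> is the remaining root of the
      cubic.\<close>
    define A B c where "A = - q / s" and "B = - p / s" and "c = of_int a - A"
    have r2: "r\<^sup>2 = of_rat A * r + of_rat B"
      using assms \<open>s \<noteq> 0\<close>
      by (simp add: A_def B_def of_rat_divide of_rat_minus field_simps)
    \<comment> \<open>The cube of \<open>r\<close> is computed from the quadratic relation and from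
      the cubic; since \<open>r\<close> is irrational, the coefficients of the two results
      agree.\<close>
    have "r ^ 3 = of_rat A * r\<^sup>2 + of_rat B * r"
      using r2 by algebra
    then have "of_rat (1 + c * B) + of_rat (c * A - B + of_int a + 3) * r = 0"
      unfolding root r2 c_def
      by (simp add: of_rat_add of_rat_diff of_rat_mult algebra_simps)
    then have B: "c * B = - 1" "B = c * A + of_int a + 3"
      using linear by fastforce+
    have "c ^ 3 - of_int a * c\<^sup>2 - (of_int a + 3) * c - 1 = - (c * (c * A + of_int a + 3)) - 1"
      by (simp add: c_def power2_eq_square power3_eq_cube algebra_simps)
    also have "\<dots> = 0"
      using B by simp
    finally have "of_rat (c ^ 3 - of_int a * c\<^sup>2 - (of_int a + 3) * c - 1) = (0 :: real)"
      by simp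
    then show False
      using rational_not_root[of "of_rat c" a]
      by (simp add: of_rat_add of_rat_diff of_rat_mult of_rat_power)
  qed
  then show ?thesis
    using assms linear by auto
qed

lemma nonzero: "r \<noteq> 0" "1 + r \<noteq> 0"
  using irrational Rats_0 Rats_minus_iff[of 1] by (auto simp: add_eq_0_iff2)

text \<open>Eliminating \<open>a\<close> turns every statement about the conjugates into an identity
  of rational functions in \<open>r\<close> alone.\<close>

lemma a_eq: "of_int a = (r ^ 3 - 3 * r - 1) / (r * (1 + r))"
proof -
  have "of_int a * (r * (1 + r)) = r ^ 3 - 3 * r - 1"
    using root by algebra
  then show ?thesis
    using nonzero by (simp add: eq_divide_eq)
qed

text \<open>The substitution sending \<open>t\<close> to \<open>- (1 + t) / t\<close> has order
  three and permutes the roots cyclically; its square sends \<open>t\<close> to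
  \<open>- 1 / (1 + t)\<close>. Hence all conjugates are real and lie in the field generated by
  \<open>r\<close>.\<close>

lemma conjugate1: "simplest_cubic_root a (- (1 + r) / r)"
  by unfold_locales (use nonzero in \<open>simp add: a_eq divide_simps\<close>, algebra)

lemma conjugate2: "simplest_cubic_root a (- 1 / (1 + r))"
  by unfold_locales (use nonzero in \<open>simp add: a_eq divide_simps\<close>, algebra)

lemma sum_conjugates: "r + - (1 + r) / r + - 1 / (1 + r) = of_int a"
  using nonzero by (simp add: a_eq divide_simps) algebra

text \<open>This is Newton's identity \<open>e1^2 - 2 e2\<close>, with \<open>e1 = a\<close> and
  \<open>e2 = - (a + 3)\<close> read off the cubic.\<close>

lemma sum_conjugates_power2:
  "r\<^sup>2 + (- (1 + r) / r)\<^sup>2 + (- 1 / (1 + r))\<^sup>2 = of_int a ^ 2 + 2 * of_int a + 6"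
  using nonzero by (simp add: a_eq divide_simps) algebra

lemma distinct: "1 \<noteq> r" "1 \<noteq> r\<^sup>2" "r \<noteq> r\<^sup>2"
  using rational_coefficients_zero[of 1 "-1" 0] rational_coefficients_zero[of 1 0 "-1"]
    rational_coefficients_zero[of 0 1 "-1"]
  by (auto simp: of_rat_minus)

section \<open>The field and the order generated by the root\<close>

lemma span_powers: "x \<in> rat_vs.span {1, r, r\<^sup>2} \<longleftrightarrow>
    (\<exists>p q s. x = of_rat p + of_rat q * r + of_rat s * r\<^sup>2)"
  by (simp add: rat_vs.span_breakdown_eq diff_eq_eq add_ac)

lemma independent_powers: "rat_vs.independent {1, r, r\<^sup>2}"
proof -
  have "1 \<notin> rat_vs.span {r, r\<^sup>2}"
  proof
    assume "1 \<in> rat_vs.span {r, r\<^sup>2}"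
    then obtain q s where "1 = of_rat q * r + of_rat s * r\<^sup>2"
      by (auto simp: rat_vs.span_breakdown_eq diff_eq_eq add_ac)
    then show False
      using rational_coefficients_zero[of "-1" q s] by simp
  qed
  moreover have "r \<notin> rat_vs.span {r\<^sup>2}"
  proof
    assume "r \<in> rat_vs.span {r\<^sup>2}"
    then obtain s where "r = of_rat s * r\<^sup>2"
      by (auto simp: rat_vs.span_breakdown_eq diff_eq_eq add_ac)
    then show False
      using rational_coefficients_zero[of 0 "-1" s] by simp
  qed
  ultimately show ?thesis
    using distinct nonzero by (simp add: rat_vs.independent_insert)
qed

text \<open>The coefficients come from the cubic and from
  \<open>r^4 = (a^2 + a + 3) r^2 + (a^2 + 3 a + 1) r + a\<close>. They are the same for every root
  of the cubic, which later makes the embeddings multiplicative.\<close>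

lemma powers_mult:
  "(of_rat p + of_rat q * r + of_rat s * r\<^sup>2) * (of_rat p' + of_rat q' * r + of_rat s' * r\<^sup>2) =
    of_rat (p * p' + q * s' + s * q' + of_int a * s * s') +
    of_rat (p * q' + q * p' + (of_int a + 3) * (q * s' + s * q') +
      (of_int a ^ 2 + 3 * of_int a + 1) * s * s') * r +
    of_rat (p * s' + q * q' + s * p' + of_int a * (q * s' + s * q') +
      (of_int a ^ 2 + of_int a + 3) * s * s') * r\<^sup>2"
proof -
  have "(P + Q * r + S * r\<^sup>2) * (P' + Q' * r + S' * r\<^sup>2) =
    (P * P' + Q * S' + S * Q' + of_int a * S * S') +
    (P * Q' + Q * P' + (of_int a + 3) * (Q * S' + S * Q') +
      (of_int a ^ 2 + 3 * of_int a + 1) * S * S') * r +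
    (P * S' + Q * Q' + S * P' + of_int a * (Q * S' + S * Q') +
      (of_int a ^ 2 + of_int a + 3) * S * S') * r\<^sup>2" for P Q S P' Q' S'
    using root by algebra
  then show ?thesis
    by (simp add: of_rat_add of_rat_mult of_rat_power)
qed

lemma span_powers_mult:
  "x \<in> rat_vs.span {1, r, r\<^sup>2} \<Longrightarrow> y \<in> rat_vs.span {1, r, r\<^sup>2} \<Longrightarrow> x * y \<in> rat_vs.span {1, r, r\<^sup>2}"
  unfolding span_powers using powers_mult by metis

lemma is_subfield_span_powers: "is_subfield (rat_vs.span {1, r, r\<^sup>2})"
  unfolding is_subfield_def is_subring_def
  by (auto intro!: rat_vs.span_zero rat_vs.span_add rat_vs.span_neg span_powers_mult
      inverse_in_finite_span independent_powers intro: rat_vs.span_base)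

lemma rat_adjoin_eq_span: "rat_adjoin r = rat_vs.span {1, r, r\<^sup>2}"
  unfolding rat_adjoin_def
proof (rule hull_unique)
  show "{r} \<subseteq> rat_vs.span {1, r, r\<^sup>2}"
    by (auto intro: rat_vs.span_base)
  show "rat_vs.span {1, r, r\<^sup>2} \<subseteq> F" if "{r} \<subseteq> F" "is_subfield F" for F
    using that is_subfield_of_rat[of F] is_subring_power[of F r]
    by (auto simp: span_powers is_subfield_def is_subring_def)
qed (rule is_subfield_span_powers)

lemma rat_adjoinE:
  assumes "x \<in> rat_adjoin r"
  obtains p q s where "x = of_rat p + of_rat q * r + of_rat s * r\<^sup>2"
  using assms unfolding rat_adjoin_eq_span span_powers by blast

lemma rat_adjoinI: "of_rat p + of_rat q * r + of_rat s * r\<^sup>2 \<in> rat_adjoin r"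
  unfolding rat_adjoin_eq_span span_powers by blast

text \<open>Since the cubic is monic and integral, the product formula \<open>powers_mult\<close>
  keeps integer coefficients integral. The integral combinations of \<open>1\<close>,
  \<open>r\<close>, \<open>r^2\<close> therefore already form a ring containing
  \<open>r\<close>.\<close>

lemma int_adjoinE:
  assumes "x \<in> int_adjoin r"
  obtains u v w where "x = of_int u + of_int v * r + of_int w * r\<^sup>2"
proof -
  let ?S = "{x. \<exists>u v w. x = of_int u + of_int v * r + of_int w * r\<^sup>2}"
  have "is_subring ?S"
    unfolding is_subring_def
  proof (intro conjI ballI)
    have "0 = of_int 0 + of_int 0 * r + of_int 0 * r\<^sup>2" "1 = of_int 1 + of_int 0 * r + of_int 0 * r\<^sup>2"
      by simp_all
    then show "0 \<in> ?S" "1 \<in> ?S"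
      by blast+
    fix x assume "x \<in> ?S"
    then obtain u v w where x: "x = of_int u + of_int v * r + of_int w * r\<^sup>2"
      by blast
    then have "- x = of_int (- u) + of_int (- v) * r + of_int (- w) * r\<^sup>2"
      by simp
    then show "- x \<in> ?S"
      by blast
    fix y assume "y \<in> ?S"
    then obtain u' v' w' where y: "y = of_int u' + of_int v' * r + of_int w' * r\<^sup>2"
      by blast
    have "x + y = of_int (u + u') + of_int (v + v') * r + of_int (w + w') * r\<^sup>2"
      unfolding x y by (simp add: algebra_simps)
    then show "x + y \<in> ?S"
      by blast
    have "x * y = of_int (u * u' + v * w' + w * v' + a * w * w') +
      of_int (u * v' + v * u' + (a + 3) * (v * w' + w * v') + (a\<^sup>2 + 3 * a + 1) * w * w') * r +
      of_int (u * w' + v * v' + w * u' + a * (v * w' + w * v') + (a\<^sup>2 + a + 3) * w * w') * r\<^sup>2"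
      using powers_mult[of "of_int u" "of_int v" "of_int w" "of_int u'" "of_int v'" "of_int w'"]
      unfolding x y by (simp add: of_rat_add of_rat_mult of_rat_power)
    then show "x * y \<in> ?S"
      by blast
  qed
  moreover have "r = of_int 0 + of_int 1 * r + of_int 0 * r\<^sup>2"
    by simp
  then have "{r} \<subseteq> ?S"
    by blast
  ultimately have "int_adjoin r \<subseteq> ?S"
    unfolding int_adjoin_def by (intro hull_minimal)
  then show ?thesis
    using assms that by blast
qed

section \<open>Embeddings determined by the conjugate roots\<close>

lemma embedding_poly:
  assumes "real_embedding (rat_adjoin r) \<sigma>"
  shows "\<sigma> (of_rat p + of_rat q * r + of_rat s * r\<^sup>2) = of_rat p + of_rat q * \<sigma> r + of_rat s * (\<sigma> r)\<^sup>2"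
proof -
  note F = is_subfield_rat_adjoin[of r]
  have r: "r \<in> rat_adjoin r"
    using rat_adjoinI[of 0 1 0] by simp
  have "of_rat q * r \<in> rat_adjoin r" "of_rat s * r\<^sup>2 \<in> rat_adjoin r"
    "r\<^sup>2 \<in> rat_adjoin r" "of_rat p + of_rat q * r \<in> rat_adjoin r"
    using rat_adjoinI[of 0 q 0] rat_adjoinI[of 0 0 s] rat_adjoinI[of 0 0 1] rat_adjoinI[of p q 0]
    by simp_all
  with r show ?thesis
    using is_subfield_of_rat[OF F]
    by (simp add: embedding_add[OF F assms] embedding_mult[OF F assms] embedding_of_rat[OF F assms]
        embedding_power[OF F assms])
qed

text \<open>The embedding replaces \<open>r\<close> by \<open>t\<close> in the expansion along the
  powers. It is well defined by the independence of the powers of \<open>r\<close>, and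
  multiplicative because \<open>powers_mult\<close> has the same coefficients at \<open>r\<close>
  and at \<open>t\<close>.\<close>

lemma ex_embedding:
  assumes "simplest_cubic_root a t"
  obtains \<sigma> where "real_embedding (rat_adjoin r) \<sigma>" "\<sigma> r = t"
proof -
  interpret t: simplest_cubic_root a t by fact
  \<comment> \<open>Outside the field no \<open>y\<close> satisfies the description, so the value
    there is arbitrary; \<open>real_embedding\<close> inspects only values on the field.\<close>
  define \<sigma> where "\<sigma> x = (THE y. \<exists>p q s. x = of_rat p + of_rat q * r + of_rat s * r\<^sup>2 \<and>
    y = of_rat p + of_rat q * t + of_rat s * t\<^sup>2)" for x
  have eval: "\<sigma> (of_rat p + of_rat q * r + of_rat s * r\<^sup>2) = of_rat p + of_rat q * t + of_rat s * t\<^sup>2"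
    for p q s
    unfolding \<sigma>_def
  proof (rule the_equality)
    fix y
    assume "\<exists>p' q' s'. of_rat p + of_rat q * r + of_rat s * r\<^sup>2 = of_rat p' + of_rat q' * r + of_rat s' * r\<^sup>2 \<and>
      y = of_rat p' + of_rat q' * t + of_rat s' * t\<^sup>2"
    then obtain p' q' s' where
      *: "of_rat p + of_rat q * r + of_rat s * r\<^sup>2 = of_rat p' + of_rat q' * r + of_rat s' * r\<^sup>2"
      and y: "y = of_rat p' + of_rat q' * t + of_rat s' * t\<^sup>2"
      by blast
    from * have "of_rat (p - p') + of_rat (q - q') * r + of_rat (s - s') * r\<^sup>2 = 0"
      by (simp add: of_rat_diff algebra_simps)
    then have "p - p' = 0 \<and> q - q' = 0 \<and> s - s' = 0"
      by (rule rational_coefficients_zero)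
    then show "y = of_rat p + of_rat q * t + of_rat s * t\<^sup>2"
      using y by simp
  qed blast
  have "real_embedding (rat_adjoin r) \<sigma>"
    unfolding real_embedding_def
  proof (intro conjI ballI)
    show "\<sigma> 1 = 1"
      using eval[of 1 0 0] by simp
    fix x y
    assume "x \<in> rat_adjoin r" "y \<in> rat_adjoin r"
    then obtain p q s p' q' s' where x: "x = of_rat p + of_rat q * r + of_rat s * r\<^sup>2"
      and y: "y = of_rat p' + of_rat q' * r + of_rat s' * r\<^sup>2"
      by (metis rat_adjoinE)
    have "x + y = of_rat (p + p') + of_rat (q + q') * r + of_rat (s + s') * r\<^sup>2"
      unfolding x y by (simp add: of_rat_add algebra_simps)
    then have "\<sigma> (x + y) = of_rat (p + p') + of_rat (q + q') * t + of_rat (s + s') * t\<^sup>2"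
      by (simp only: eval)
    then show "\<sigma> (x + y) = \<sigma> x + \<sigma> y"
      unfolding x y eval by (simp add: of_rat_add algebra_simps)
    show "\<sigma> (x * y) = \<sigma> x * \<sigma> y"
      unfolding x y powers_mult eval t.powers_mult ..
  qed
  moreover have "\<sigma> r = t"
    using eval[of 0 1 0] by simp
  ultimately show ?thesis
    using that by blast
qed

section \<open>The trace in coordinates and as a sum of embeddings\<close>

lemma representation_powers:
  "rat_vs.representation {1, r, r\<^sup>2} (of_rat p + of_rat q * r + of_rat s * r\<^sup>2) =
    (\<lambda>b. if b = 1 then p else if b = r then q else if b = r\<^sup>2 then s else 0)"
proof -
  let ?R = "rat_vs.representation {1, r, r\<^sup>2}"
  have span: "1 \<in> rat_vs.span {1, r, r\<^sup>2}" "r \<in> rat_vs.span {1, r, r\<^sup>2}" "r\<^sup>2 \<in> rat_vs.span {1, r, r\<^sup>2}"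
    by (auto intro: rat_vs.span_base)
  \<comment> \<open>The factor 1 is kept so that the constant term appears as a scalar multiple of a
    basis vector.\<close>
  have "?R (of_rat p * 1 + of_rat q * r + of_rat s * r\<^sup>2) b =
    p * ?R 1 b + q * ?R r b + s * ?R (r\<^sup>2) b" for b
    using independent_powers span
    by (simp add: rat_vs.representation_add rat_vs.representation_scale[of _ _ p, simplified]
        rat_vs.representation_scale rat_vs.span_add rat_vs.span_scale
        rat_vs.span_scale[of _ _ p, simplified] del: mult_1_right)
  then show ?thesis
    using distinct distinct[symmetric] by (auto simp: rat_vs.representation_basis[OF independent_powers])
qed

text \<open>The diagonal entries of multiplication in the basis \<open>1\<close>, \<open>r\<close>,
  \<open>r^2\<close> are \<open>p\<close>, \<open>p + (a + 3) s\<close> and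
  \<open>p + a q + (a^2 + a + 3) s\<close>.\<close>

lemma field_trace_poly:
  "field_trace (rat_adjoin r) (of_rat p + of_rat q * r + of_rat s * r\<^sup>2) =
    3 * p + of_int a * q + (of_int a ^ 2 + 2 * of_int a + 6) * s"
proof -
  let ?x = "of_rat p + of_rat q * r + of_rat s * r\<^sup>2 :: real"
  have "?x * r = of_rat s + of_rat (p + (of_int a + 3) * s) * r + of_rat (q + of_int a * s) * r\<^sup>2"
    using powers_mult[of p q s 0 1 0] by (simp add: algebra_simps)
  moreover have "?x * r\<^sup>2 = of_rat (q + of_int a * s) +
      of_rat ((of_int a + 3) * q + (of_int a ^ 2 + 3 * of_int a + 1) * s) * r +
      of_rat (p + of_int a * q + (of_int a ^ 2 + of_int a + 3) * s) * r\<^sup>2"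
    using powers_mult[of p q s 0 0 1] by (simp add: algebra_simps)
  moreover have "field_trace (rat_adjoin r) ?x =
      (\<Sum>c\<in>{1, r, r\<^sup>2}. rat_vs.representation {1, r, r\<^sup>2} (?x * c) c)"
    using independent_powers span_powers_mult rat_adjoinI[of p q s]
    by (intro field_trace_eq_diagonal_sum) (auto simp: rat_adjoin_eq_span)
  ultimately show ?thesis
    using distinct distinct[symmetric] by (simp add: representation_powers) (simp add: algebra_simps)
qed

text \<open>The summand \<open>x\<close> belongs to the identity embedding. Both sides are linear in
  the coordinates of \<open>x\<close>, so the power sums of the conjugates settle the claim.\<close>

lemma field_trace_eq_sum_embeddings:
  assumes "x \<in> rat_adjoin r"
    and \<sigma>: "real_embedding (rat_adjoin r) \<sigma>" "\<sigma> r = - (1 + r) / r"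
    and \<tau>: "real_embedding (rat_adjoin r) \<tau>" "\<tau> r = - 1 / (1 + r)"
  shows "of_rat (field_trace (rat_adjoin r) x) = x + \<sigma> x + \<tau> x"
proof -
  obtain p q s where x: "x = of_rat p + of_rat q * r + of_rat s * r\<^sup>2"
    using assms(1) by (rule rat_adjoinE)
  have "x + \<sigma> x + \<tau> x = 3 * of_rat p + of_rat q * (r + - (1 + r) / r + - 1 / (1 + r)) +
      of_rat s * (r\<^sup>2 + (- (1 + r) / r)\<^sup>2 + (- 1 / (1 + r))\<^sup>2)"
    unfolding x embedding_poly[OF \<sigma>(1)] embedding_poly[OF \<tau>(1)] \<sigma>(2) \<tau>(2)
    by (simp only: distrib_left)
  also have "\<dots> = of_rat (field_trace (rat_adjoin r) x)"
    unfolding sum_conjugates sum_conjugates_power2 x field_trace_poly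
    by (simp add: of_rat_add of_rat_mult of_rat_power algebra_simps)
  finally show ?thesis ..
qed

section \<open>Squares in the codifferent and their traces\<close>

lemma norm_form_pos: "0 < 1 + r + r\<^sup>2"
proof -
  have "1 + r + r\<^sup>2 = (r + 1 / 2)\<^sup>2 + 3 / 4"
    by (simp add: power2_eq_square algebra_simps)
  then show ?thesis
    by (simp add: add_nonneg_pos)
qed

lemma int_poly_in_int_adjoin: "of_int u + of_int v * r + of_int w * r\<^sup>2 \<in> int_adjoin r"
proof -
  have "r \<in> int_adjoin r"
    unfolding int_adjoin_def by (simp add: hull_inc)
  then show ?thesis
    using is_subring_int_adjoin[of r] is_subring_of_int is_subring_power
    by (simp add: is_subring_def)
qed

lemma int_poly_in_rat_adjoin: "of_int u + of_int v * r + of_int w * r\<^sup>2 \<in> rat_adjoin r"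
  using rat_adjoinI[of "of_int u" "of_int v" "of_int w"] by simp

lemma embedding_int_poly:
  assumes "real_embedding (rat_adjoin r) \<sigma>"
  shows "\<sigma> (of_int u + of_int v * r + of_int w * r\<^sup>2) = of_int u + of_int v * \<sigma> r + of_int w * (\<sigma> r)\<^sup>2"
  using embedding_poly[OF assms, of "of_int u" "of_int v" "of_int w"] by simp

text \<open>With \<open>N = 1 + r + r^2\<close>, the derivative of the cubic at \<open>r\<close> is
  \<open>N^2 / (r (1 + r))\<close>, and \<open>r\<close> and \<open>1 + r\<close> are units. So
  \<open>1 / N^2\<close> generates the codifferent of the order generated by \<open>r\<close>, and
  these are the multiples of it by squares of \<open>x + y r\<close>.\<close>

definition dual_square :: "int \<Rightarrow> int \<Rightarrow> real" where
  "dual_square x y = ((of_int x + of_int y * r) / (1 + r + r\<^sup>2))\<^sup>2"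

lemma dual_square_root_in_rat_adjoin: "(of_int x + of_int y * r) / (1 + r + r\<^sup>2) \<in> rat_adjoin r"
  using is_subfield_rat_adjoin[of r] int_poly_in_rat_adjoin[of x y 0] int_poly_in_rat_adjoin[of 1 1 1]
    norm_form_pos
  by (simp add: is_subfield_def is_subring_def divide_inverse)

lemma dual_square_in_rat_adjoin: "dual_square x y \<in> rat_adjoin r"
  unfolding dual_square_def
  using is_subfield_rat_adjoin[of r] dual_square_root_in_rat_adjoin[of x y]
  by (intro is_subring_power) (auto simp: is_subfield_def)

lemma totally_positive_dual_square:
  assumes "(x, y) \<noteq> (0, 0)"
  shows "totally_positive (rat_adjoin r) (dual_square x y)"
  unfolding dual_square_def
proof (rule totally_positive_power2[OF is_subfield_rat_adjoin dual_square_root_in_rat_adjoin])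
  have "of_int x + of_int y * r \<noteq> 0"
    using rational_coefficients_zero[of "of_int x" "of_int y" 0] assms by auto
  then show "(of_int x + of_int y * r) / (1 + r + r\<^sup>2) \<noteq> 0"
    using norm_form_pos by simp
qed

lemma embedding_dual_square_mult:
  assumes \<sigma>: "real_embedding (rat_adjoin r) \<sigma>"
  shows "\<sigma> ((of_int u + of_int v * r + of_int w * r\<^sup>2) * dual_square x y) =
    (of_int u + of_int v * \<sigma> r + of_int w * (\<sigma> r)\<^sup>2) *
      ((of_int x + of_int y * \<sigma> r) / (1 + \<sigma> r + (\<sigma> r)\<^sup>2))\<^sup>2"
proof -
  note F = is_subfield_rat_adjoin[of r]
  have "inverse (1 + r + r\<^sup>2) \<in> rat_adjoin r"
    using F int_poly_in_rat_adjoin[of 1 1 1] norm_form_pos by (simp add: is_subfield_def)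
  then have "\<sigma> ((of_int x + of_int y * r) / (1 + r + r\<^sup>2)) =
      (of_int x + of_int y * \<sigma> r) / (1 + \<sigma> r + (\<sigma> r)\<^sup>2)"
    using int_poly_in_rat_adjoin[of x y 0] int_poly_in_rat_adjoin[of 1 1 1]
      embedding_int_poly[OF \<sigma>, of x y 0] embedding_int_poly[OF \<sigma>, of 1 1 1]
    by (simp add: divide_inverse embedding_mult[OF F \<sigma>] embedding_inverse[OF F \<sigma>])
  then show ?thesis
    using int_poly_in_rat_adjoin[of u v w] dual_square_in_rat_adjoin[of x y]
    by (simp add: embedding_mult[OF F \<sigma>] embedding_int_poly[OF \<sigma>])
      (simp add: dual_square_def embedding_power[OF F \<sigma>] dual_square_root_in_rat_adjoin)
qed

text \<open>The trace is the sum over the three embeddings, brought to the common denominator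
  \<open>N^2\<close>. The result is free of \<open>a\<close>.\<close>

lemma trace_dual_square:
  fixes u v w x y :: int
  defines "g \<equiv> (\<lambda>t :: real. of_int u + of_int v * t + of_int w * t\<^sup>2)"
  shows "of_rat (field_trace (rat_adjoin r) ((of_int u + of_int v * r + of_int w * r\<^sup>2) * dual_square x y)) =
    (g r * (of_int x + of_int y * r)\<^sup>2 + g (- (1 + r) / r) * (of_int x * r - of_int y * (1 + r))\<^sup>2 * r\<^sup>2 +
      g (- 1 / (1 + r)) * (of_int x * (1 + r) - of_int y)\<^sup>2 * (1 + r)\<^sup>2) / (1 + r + r\<^sup>2)\<^sup>2"
proof -
  obtain \<sigma> where \<sigma>: "real_embedding (rat_adjoin r) \<sigma>" "\<sigma> r = - (1 + r) / r"
    using ex_embedding[OF conjugate1] .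
  obtain \<tau> where \<tau>: "real_embedding (rat_adjoin r) \<tau>" "\<tau> r = - 1 / (1 + r)"
    using ex_embedding[OF conjugate2] .
  let ?N = "1 + r + r\<^sup>2"
  \<comment> \<open>Each further conjugate of \<open>N\<close> is \<open>N\<close> divided by the
    square of a unit, which is why a common denominator \<open>N^2\<close> suffices.\<close>
  have N1: "1 + \<sigma> r + (\<sigma> r)\<^sup>2 = ?N / r\<^sup>2" and N2: "1 + \<tau> r + (\<tau> r)\<^sup>2 = ?N / (1 + r)\<^sup>2"
    unfolding \<sigma>(2) \<tau>(2) using nonzero
    by (simp add: divide_simps; algebra)+
  have L1: "of_int x + of_int y * \<sigma> r = (of_int x * r - of_int y * (1 + r)) / r"
    and L2: "of_int x + of_int y * \<tau> r = (of_int x * (1 + r) - of_int y) / (1 + r)"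
    unfolding \<sigma>(2) \<tau>(2) using nonzero by (simp add: field_simps)+
  \<comment> \<open>Both nontrivial conjugates of the squared factor have this shape, with
    \<open>t = r\<close> and \<open>t = 1 + r\<close>.\<close>
  have quotient: "(X / t / (?N / t\<^sup>2))\<^sup>2 = X\<^sup>2 * t\<^sup>2 / ?N\<^sup>2" if "t \<noteq> 0" for X t :: real
    using that norm_form_pos by (simp add: power2_eq_square)
  have mem: "(of_int u + of_int v * r + of_int w * r\<^sup>2) * dual_square x y \<in> rat_adjoin r"
    using is_subfield_rat_adjoin[of r] int_poly_in_rat_adjoin dual_square_in_rat_adjoin
    by (simp add: is_subfield_def is_subring_def)
  show ?thesis
    unfolding field_trace_eq_sum_embeddings[OF mem \<sigma> \<tau>] embedding_dual_square_mult[OF \<sigma>(1)]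
      embedding_dual_square_mult[OF \<tau>(1)] N1 N2 L1 L2
      quotient[OF nonzero(1)] quotient[OF nonzero(2)]
    unfolding \<sigma>(2) \<tau>(2) g_def dual_square_def power_divide
    by (simp add: add_divide_distrib mult.assoc)
qed

text \<open>In each case \<open>N^2\<close> divides the numerator identically in \<open>r\<close>,
  leaving an integral linear form in \<open>u\<close>, \<open>v\<close>, \<open>w\<close>.\<close>

lemma trace_dual_square_values:
  shows "field_trace (rat_adjoin r) ((of_int u + of_int v * r + of_int w * r\<^sup>2) * dual_square 1 1) =
      of_int (u + w)" (is ?A)
    and "field_trace (rat_adjoin r) ((of_int u + of_int v * r + of_int w * r\<^sup>2) * dual_square 0 1) =
      of_int (u - v + 2 * w)" (is ?B)
    and "field_trace (rat_adjoin r) ((of_int u + of_int v * r + of_int w * r\<^sup>2) * dual_square 1 0) =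
      of_int (2 * u - v + w)" (is ?C)
proof -
  have eqI: "p = of_int n" if "of_rat p = (of_int n :: real)" for p n
    using that by (metis of_rat_eq_iff of_rat_of_int_eq)
  have N: "1 + r + r\<^sup>2 \<noteq> 0"
    using norm_form_pos by simp
  show ?A
    by (rule eqI, subst trace_dual_square)
      (use nonzero in \<open>simp add: divide_eq_eq N; simp add: divide_simps; algebra\<close>)
  show ?B
    by (rule eqI, subst trace_dual_square)
      (use nonzero in \<open>simp add: divide_eq_eq N; simp add: divide_simps; algebra\<close>)
  show ?C
    by (rule eqI, subst trace_dual_square)
      (use nonzero in \<open>simp add: divide_eq_eq N; simp add: divide_simps; algebra\<close>)
qed

text \<open>By \<open>O\<close>, integrality need only be tested on integral combinations of the
  powers of \<open>r\<close>, where the trace is one of the three linear forms above.\<close>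

lemma dual_square_positive_codifferent:
  assumes O: "ring_of_integers (rat_adjoin r) = int_adjoin r"
    and "(x, y) \<in> {(1, 1), (0, 1), (1, 0)}"
  shows "dual_square x y \<in> positive_codifferent (rat_adjoin r)"
proof -
  have "field_trace (rat_adjoin r) (\<alpha> * dual_square x y) \<in> \<int>" if "\<alpha> \<in> int_adjoin r" for \<alpha>
    using that
  proof (rule int_adjoinE)
    fix u v w assume \<alpha>: "\<alpha> = of_int u + of_int v * r + of_int w * r\<^sup>2"
    show ?thesis
      using assms(2) trace_dual_square_values[of u v w] unfolding \<alpha> by auto
  qed
  then show ?thesis
    using assms totally_positive_dual_square[of x y] dual_square_in_rat_adjoin
    by (auto simp: positive_codifferent_def codifferent_def)
qed

section \<open>Positivity and integrality of traces\<close>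

lemma field_trace_add:
  assumes "x \<in> rat_adjoin r" "y \<in> rat_adjoin r"
  shows "field_trace (rat_adjoin r) (x + y) = field_trace (rat_adjoin r) x + field_trace (rat_adjoin r) y"
proof -
  obtain p q s p' q' s' where x: "x = of_rat p + of_rat q * r + of_rat s * r\<^sup>2"
    and y: "y = of_rat p' + of_rat q' * r + of_rat s' * r\<^sup>2"
    using assms by (metis rat_adjoinE)
  have "x + y = of_rat (p + p') + of_rat (q + q') * r + of_rat (s + s') * r\<^sup>2"
    unfolding x y by (simp add: of_rat_add algebra_simps)
  then show ?thesis
    by (simp only: x y field_trace_poly) (simp add: algebra_simps)
qed

lemma field_trace_pos:
  assumes "x \<in> rat_adjoin r" "totally_positive (rat_adjoin r) x"
  shows "0 < field_trace (rat_adjoin r) x"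
proof -
  obtain \<sigma> where \<sigma>: "real_embedding (rat_adjoin r) \<sigma>" "\<sigma> r = - (1 + r) / r"
    using ex_embedding[OF conjugate1] .
  obtain \<tau> where \<tau>: "real_embedding (rat_adjoin r) \<tau>" "\<tau> r = - 1 / (1 + r)"
    using ex_embedding[OF conjugate2] .
  have "real_embedding (rat_adjoin r) (\<lambda>x. x)"
    by (simp add: real_embedding_def)
  then have "0 < x + \<sigma> x + \<tau> x"
    using assms(2) \<sigma>(1) \<tau>(1) unfolding totally_positive_def by (metis add_pos_pos)
  then show ?thesis
    by (simp flip: field_trace_eq_sum_embeddings[OF assms(1) \<sigma> \<tau>])
qed

lemma totally_positive_mult:
  assumes "x \<in> rat_adjoin r" "y \<in> rat_adjoin r"
    "totally_positive (rat_adjoin r) x" "totally_positive (rat_adjoin r) y"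
  shows "totally_positive (rat_adjoin r) (x * y)"
  using assms by (simp add: totally_positive_def embedding_mult[OF is_subfield_rat_adjoin])

text \<open>The product is totally positive, so its trace is positive; the codifferent makes that
  trace an integer.\<close>

lemma codifferent_trace_ge_one:
  assumes "\<alpha> \<in> positive_integers (rat_adjoin r)" "\<delta> \<in> positive_codifferent (rat_adjoin r)"
  obtains n where "field_trace (rat_adjoin r) (\<alpha> * \<delta>) = of_int n" "1 \<le> n"
proof -
  have mem: "\<alpha> \<in> ring_of_integers (rat_adjoin r)" "totally_positive (rat_adjoin r) \<alpha>" "\<alpha> \<in> rat_adjoin r"
    "\<delta> \<in> rat_adjoin r" "totally_positive (rat_adjoin r) \<delta>"
    "field_trace (rat_adjoin r) (\<alpha> * \<delta>) \<in> \<int>"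
    using assms by (auto simp: positive_integers_def positive_codifferent_def codifferent_def ring_of_integers_def)
  then obtain n where n: "field_trace (rat_adjoin r) (\<alpha> * \<delta>) = of_int n"
    by (auto elim: Ints_cases)
  moreover have "\<alpha> * \<delta> \<in> rat_adjoin r"
    using mem is_subfield_rat_adjoin[of r] by (simp add: is_subfield_def is_subring_def)
  then have "0 < field_trace (rat_adjoin r) (\<alpha> * \<delta>)"
    using mem by (intro field_trace_pos totally_positive_mult)
  ultimately show ?thesis
    using that by simp
qed

section \<open>The minimal trace and indecomposability\<close>

context
  assumes O: "ring_of_integers (rat_adjoin r) = int_adjoin r"
begin

lemma square_positive_integer:
  assumes "(x, y) \<noteq> (0, 0)"
  shows "(of_int x + of_int y * r)\<^sup>2 \<in> positive_integers (rat_adjoin r)"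
proof -
  have "of_int x + of_int y * r \<noteq> 0"
    using rational_coefficients_zero[of "of_int x" "of_int y" 0] assms by auto
  then show ?thesis
    using int_poly_in_int_adjoin[of x y 0] int_poly_in_rat_adjoin[of x y 0] is_subring_int_adjoin[of r]
    by (simp add: positive_integers_def O is_subring_power totally_positive_power2 is_subfield_rat_adjoin)
qed

lemma norm_form_positive_integer: "1 + r + r\<^sup>2 \<in> positive_integers (rat_adjoin r)"
proof -
  have "0 < \<sigma> (1 + r + r\<^sup>2)" if "real_embedding (rat_adjoin r) \<sigma>" for \<sigma>
  proof -
    have "\<sigma> (1 + r + r\<^sup>2) = (\<sigma> r + 1 / 2)\<^sup>2 + 3 / 4"
      using embedding_int_poly[OF that, of 1 1 1] by (simp add: power2_eq_square algebra_simps)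
    then show ?thesis
      by (simp add: add_nonneg_pos)
  qed
  then show ?thesis
    using int_poly_in_int_adjoin[of 1 1 1] by (simp add: positive_integers_def O totally_positive_def)
qed

lemma trace_norm_form_ge_two:
  assumes \<delta>: "\<delta> \<in> positive_codifferent (rat_adjoin r)"
  shows "2 \<le> field_trace (rat_adjoin r) ((1 + r + r\<^sup>2) * \<delta>)"
proof -
  let ?T = "\<lambda>\<alpha>. field_trace (rat_adjoin r) (\<alpha> * \<delta>)"
  obtain k where k: "?T (1 + r + r\<^sup>2) = of_int k"
    using codifferent_trace_ge_one[OF norm_form_positive_integer \<delta>] .
  obtain l where l: "?T 1 = of_int l" "1 \<le> l"
    using codifferent_trace_ge_one[OF square_positive_integer[of 1 0] \<delta>] by auto
  obtain m where m: "?T (r\<^sup>2) = of_int m" "1 \<le> m"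
    using codifferent_trace_ge_one[OF square_positive_integer[of 0 1] \<delta>] by auto
  obtain n where n: "?T ((1 + r)\<^sup>2) = of_int n" "1 \<le> n"
    using codifferent_trace_ge_one[OF square_positive_integer[of 1 1] \<delta>] by auto
  have \<delta>_mem: "\<delta> \<in> rat_adjoin r"
    using \<delta> by (simp add: positive_codifferent_def codifferent_def)
  then have mem: "(of_int u + of_int v * r + of_int w * r\<^sup>2) * \<delta> \<in> rat_adjoin r" for u v w
    using is_subfield_rat_adjoin[of r] int_poly_in_rat_adjoin[of u v w]
    by (simp add: is_subfield_def is_subring_def)
  \<comment> \<open>These are the side conditions for splitting the trace of the identity below;
    \<open>1 * \<delta>\<close> keeps the shape of \<open>?T 1\<close>.\<close>
  have mem': "1 * \<delta> \<in> rat_adjoin r" "r\<^sup>2 * \<delta> \<in> rat_adjoin r" "(1 + r)\<^sup>2 * \<delta> \<in> rat_adjoin r"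
    "(1 + r + r\<^sup>2) * \<delta> \<in> rat_adjoin r" "1 * \<delta> + r\<^sup>2 * \<delta> \<in> rat_adjoin r"
    using mem[of 1 0 0] mem[of 0 0 1] mem[of 1 2 1] mem[of 1 1 1] mem[of 1 0 1]
    by (simp_all add: power2_eq_square algebra_simps)
  have "(1 + r + r\<^sup>2) * \<delta> + (1 + r + r\<^sup>2) * \<delta> = 1 * \<delta> + r\<^sup>2 * \<delta> + (1 + r)\<^sup>2 * \<delta>"
    by (simp add: power2_eq_square algebra_simps)
  then have "?T (1 + r + r\<^sup>2) + ?T (1 + r + r\<^sup>2) = ?T 1 + ?T (r\<^sup>2) + ?T ((1 + r)\<^sup>2)"
    using field_trace_add mem' by metis
  then have "of_int (k + k) = (of_int (l + m + n) :: rat)"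
    unfolding k l m n by simp
  \<comment> \<open>Here \<open>2 * k = l + m + n\<close> is at least 3, and \<open>k\<close> is an
    integer.\<close>
  then have "2 \<le> k"
    using l(2) m(2) n(2) by linarith
  then show ?thesis
    unfolding k by simp
qed

text \<open>All three linear forms take the value 2 at \<open>u = v = w = 1\<close>. This shows that
  the lower bound is attained and leaves no freedom for the traces of the summands in a
  decomposition.\<close>

lemma trace_norm_form_dual_square:
  assumes "(x, y) \<in> {(1, 1), (0, 1), (1, 0)}"
  shows "field_trace (rat_adjoin r) ((1 + r + r\<^sup>2) * dual_square x y) = 2"
  using assms trace_dual_square_values[of 1 1 1] by auto

lemma indecomposable_norm_form: "indecomposable (rat_adjoin r) (1 + r + r\<^sup>2)"
proof -
  have False if \<beta>: "\<beta> \<in> positive_integers (rat_adjoin r)" and \<gamma>: "\<gamma> \<in> positive_integers (rat_adjoin r)"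
    and sum: "1 + r + r\<^sup>2 = \<beta> + \<gamma>" for \<beta> \<gamma>
  proof -
    have trace: "field_trace (rat_adjoin r) (\<beta> * dual_square x y) = 1"
      if xy: "(x, y) \<in> {(1, 1), (0, 1), (1, 0)}" for x y
    proof -
      note \<delta> = dual_square_positive_codifferent[OF O xy]
      obtain m where m: "field_trace (rat_adjoin r) (\<beta> * dual_square x y) = of_int m" "1 \<le> m"
        using codifferent_trace_ge_one[OF \<beta> \<delta>] .
      obtain n where n: "field_trace (rat_adjoin r) (\<gamma> * dual_square x y) = of_int n" "1 \<le> n"
        using codifferent_trace_ge_one[OF \<gamma> \<delta>] .
      have "\<beta> * dual_square x y \<in> rat_adjoin r" "\<gamma> * dual_square x y \<in> rat_adjoin r"
        using \<beta> \<gamma> dual_square_in_rat_adjoin is_subfield_rat_adjoin[of r]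
        by (auto simp: positive_integers_def ring_of_integers_def is_subfield_def is_subring_def)
      then have "2 = (of_int (m + n) :: rat)"
        using trace_norm_form_dual_square[OF xy] m(1) n(1)
        by (simp add: sum distrib_right field_trace_add)
      \<comment> \<open>With \<open>m\<close> and \<open>n\<close> both at least 1, each of them
        must equal 1.\<close>
      then have "m + n = 2"
        by linarith
      then show ?thesis
        using m n by simp
    qed
    have "\<beta> \<in> int_adjoin r"
      using \<beta> by (simp add: positive_integers_def O)
    then obtain u v w where uvw: "\<beta> = of_int u + of_int v * r + of_int w * r\<^sup>2"
      by (rule int_adjoinE)
    have "of_int (u + w) = (1 :: rat)" "of_int (u - v + 2 * w) = (1 :: rat)"
      "of_int (2 * u - v + w) = (1 :: rat)"
      using trace[of 1 1] trace[of 0 1] trace[of 1 0] unfolding uvw trace_dual_square_values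
      by blast+
    then have "u + w = 1" "u - v + 2 * w = 1" "2 * u - v + w = 1"
      by linarith+
    \<comment> \<open>The last two equations differ by \<open>w - u = 0\<close>, so the first
      becomes \<open>2 * u = 1\<close>, impossible by parity.\<close>
    then show False
      by presburger
  qed
  then show ?thesis
    using norm_form_positive_integer by (auto simp: indecomposable_def)
qed

lemma minimum_trace_norm_form:
  "is_minimum 2 ((\<lambda>\<delta>. field_trace (rat_adjoin r) ((1 + r + r\<^sup>2) * \<delta>)) ` positive_codifferent (rat_adjoin r))"
proof -
  have "2 = field_trace (rat_adjoin r) ((1 + r + r\<^sup>2) * dual_square 1 1)"
    by (simp add: trace_norm_form_dual_square)
  then show ?thesis
    using dual_square_positive_codifferent[OF O, of 1 1] trace_norm_form_ge_two
    by (auto simp: is_minimum_def)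
qed

end

end

theorem lemma5p2:
  fixes a :: int and \<rho> :: real and K :: "real set"
  assumes "a \<ge> -1"
    and "\<rho>^3 - of_int a * \<rho>^2 - (of_int a + 3) * \<rho> - 1 = 0"
    and "\<forall>x::real. x^3 - of_int a * x^2 - (of_int a + 3) * x - 1 = 0 \<longrightarrow> x \<le> \<rho>"
    and "K = rat_adjoin \<rho>"
    and "ring_of_integers K = int_adjoin \<rho>"
  shows "indecomposable K (1 + \<rho> + \<rho>^2) \<and>
    is_minimum 2 ((\<lambda>\<delta>. field_trace K ((1 + \<rho> + \<rho>^2) * \<delta>)) ` positive_codifferent K)"
proof -
  interpret simplest_cubic_root a \<rho>
    by unfold_locales (use assms(2) in simp)
  have "ring_of_integers (rat_adjoin \<rho>) = int_adjoin \<rho>"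
    using assms(4,5) by simp
  then show ?thesis
    unfolding assms(4) using indecomposable_norm_form minimum_trace_norm_form by blast
qed

end
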